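(* Let $\kappa,T_{\rm i}>0$, fix $T_+>0$, $p_+>0$, put $\widehat A_+=\sqrt{T_+^{5/2}/(\kappa p_+)}$, and let $(\alpha_-,T_-)$, with $\alpha_-\in(0,1)$ and $T_->0$, lie on the approximate Hugoniot locus of $(p_+,T_+)$ (defined in the context). If $T_->T_+$, then $$0<\alpha_-<\widehat A_+\left(\frac{T_-}{T_+}\right)^{3/4}e^{-\frac{T_{\rm i}}{2T_-}}=\sqrt{\frac{T_+T_{\rm i}^{3/2}}{\kappa p_+}}\left(\frac{T_-}{T_{\rm i}}\right)^{3/4}e^{-\frac{T_{\rm i}}{2T_-}} .$$ Moreover, if $$\sqrt{\frac{T_+T_{\rm i}^{3/2}}{\kappa p_+}}\le 5.1670\times10^{9},$$ then the approximate Hugoniot curve issuing from $(p_+,T_+)$, i.e. the set of points $(\alpha_-,T_-)$ of the approximate Hugoniot locus with $T_->T_+$, is located in a genuinely nonlinear region.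
   Context: Model: one-dimensional ionized monatomic gas with degree of ionization $\alpha\in(0,1)$, temperature $T>0$, velocity $u$, and constants $a>0$, $\kappa>0$ (Saha constant), $T_{\rm i}>0$ (ionization temperature). Put $\theta=(1+\alpha)T$. Pressure, density and dimensionless entropy are $$p(\alpha,T)=\frac1\kappa\frac{1-\alpha^2}{\alpha^2}T^{5/2}e^{-T_{\rm i}/T},\qquad \rho=\frac{p}{a^2\theta},\qquad \eta(\alpha,T)=2\log\frac{\alpha}{1-\alpha}+(1+\alpha)\left(\frac52+\frac{T_{\rm i}}{T}\right)+\text{const},$$ the specific entropy is $S=a^2\eta$, and $v=1/\rho$. The sound speed is $c=\sqrt{p_\rho(\rho,S)}$, namely $$c=a\sqrt{\frac{5\theta}{3}}\sqrt{\frac{1+\alpha(1-\alpha)\left(\frac54+\frac{T_{\rm i}}{T}+\frac{T_{\rm i}^2}{5T^2}\right)}{1+\alpha(1-\alpha)\left(\frac54+\frac{T_{\rm i}}{T}+\frac{T_{\rm i}^2}{3T^2}\right)}} .$$ Genuine nonlinearity: in the variables $(\rho,u,S)$ the Euler system $\rho_t+(\rho u)_x=0$, $(\rho u)_t+(\rho u^2+p)_x=0$, $(\rho E)_t+(\rho uE+pu)_x=0$, with $E=\frac{u^2}2+\frac32a^2\theta+a^2T_{\rm i}\alpha$, has 1- and 2-eigenvalues $\lambda_1=u-c$, $\lambda_2=u+c$, with characteristic vectors $R_1=(-1,c/\rho,0)^T$, $R_2=(1,c/\rho,0)^T$, and $$R_1\cdot\nabla\lambda_1=R_2\cdot\nabla\lambda_2=\frac{\partial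 c}{\partial\rho}\Big|_S+\frac c\rho=\frac{p_{vv}}{2\rho^3\sqrt{-p_v}},$$ derivatives in $v$ being at constant $S$. A region of the $(\alpha,T)$-plane is called genuinely nonlinear if both the 1- and 2-characteristic directions are genuinely nonlinear there, i.e. the quantity $R_1\cdot\nabla\lambda_1=R_2\cdot\nabla\lambda_2=\frac{p_{vv}}{2\rho^3\sqrt{-p_v}}$ does not vanish there. Approximate Hugoniot locus: in the approximation $\alpha_+\sim0$, $e^{-T_{\rm i}/T_+}\sim0$ for the state ahead of the shock, the thermodynamic part of the Rankine-Hugoniot condition is replaced by the following approximate condition, in which $T_+,p_+$ are given. The approximate Hugoniot locus of $(p_+,T_+)$ is the set of $(\alpha_-,T_-)\in(0,1)\times(0,\infty)$ satisfying $$\frac{T_-}{T_+}\left[\left(4+\frac{p_+}{p_-}\right)(1+\alpha_-)+\frac{2T_{\rm i}}{T_-}\alpha_-\right]=4+\frac{p_-}{p_+},\quad\text{where}\quad \frac{p_+}{p_-}=\frac{\alpha_-^2}{\widehat A_+^2(1-\alpha_-^2)}\left(\frac{T_+}{T_-}\right)^{5/2}e^{T_{\rm i}/T_-} .$$ *)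

theory Defs
  imports "HOL-Analysis.Analysis"
begin

text \<open>
  Thermodynamic states are pairs \<open>(\<alpha>, T)\<close> of degree of ionization and temperature.
  The parameter \<open>h\<close> below is the arbitrary additive constant of the dimensionless entropy.
\<close>

definition states :: "(real \<times> real) set" where
  "states = {0<..<1} \<times> {0<..}"

definition pressure :: "real \<Rightarrow> real \<Rightarrow> real \<Rightarrow> real \<Rightarrow> real" where
  "pressure \<kappa> Ti \<alpha> T =
     1 / \<kappa> * ((1 - \<alpha>\<^sup>2) / \<alpha>\<^sup>2) * T powr (5/2) * exp (- Ti / T)"

definition density :: "real \<Rightarrow> real \<Rightarrow> real \<Rightarrow> real \<Rightarrow> real \<Rightarrow> real" where
  "density a \<kappa> Ti \<alpha> T = pressure \<kappa> Ti \<alpha> T / (a\<^sup>2 * ((1 + \<alpha>) * T))"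

definition eta :: "real \<Rightarrow> real \<Rightarrow> real \<Rightarrow> real \<Rightarrow> real" where
  "eta Ti h \<alpha> T = 2 * ln (\<alpha> / (1 - \<alpha>)) + (1 + \<alpha>) * (5/2 + Ti / T) + h"

definition entropy :: "real \<Rightarrow> real \<Rightarrow> real \<Rightarrow> real \<Rightarrow> real \<Rightarrow> real" where
  "entropy a Ti h \<alpha> T = a\<^sup>2 * eta Ti h \<alpha> T"

text \<open>
  The pressure as a function \<open>p(\<rho>, S)\<close> of density and specific entropy.  The map
  \<open>(\<alpha>, T) \<mapsto> (\<rho>, S)\<close> is injective on \<open>states\<close>: along an isentrope \<open>T\<close> is an explicit function
  of \<open>\<alpha>\<close>, and the density is strictly increasing in \<open>\<alpha>\<close>.
  Outside the image of this map the value is meaningless.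
\<close>

definition pressure_rS ::
    "real \<Rightarrow> real \<Rightarrow> real \<Rightarrow> real \<Rightarrow> real \<Rightarrow> real \<Rightarrow> real" where
  "pressure_rS a \<kappa> Ti h \<rho> S =
     (case the_inv_into states (\<lambda>(\<alpha>, T). (density a \<kappa> Ti \<alpha> T, entropy a Ti h \<alpha> T)) (\<rho>, S)
      of (\<alpha>, T) \<Rightarrow> pressure \<kappa> Ti \<alpha> T)"

definition sound_speed ::
    "real \<Rightarrow> real \<Rightarrow> real \<Rightarrow> real \<Rightarrow> real \<Rightarrow> real \<Rightarrow> real" where
  "sound_speed a \<kappa> Ti h \<rho> S = sqrt (deriv (\<lambda>r. pressure_rS a \<kappa> Ti h r S) \<rho>)"

text \<open>
  Eigenvalues and characteristic vectors of the acoustic families of the Euler system,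
  in the variables \<open>(\<rho>, u, S)\<close>.
\<close>

type_synonym flow_state = "real \<times> real \<times> real"

definition lambda1 :: "real \<Rightarrow> real \<Rightarrow> real \<Rightarrow> real \<Rightarrow> flow_state \<Rightarrow> real" where
  "lambda1 a \<kappa> Ti h = (\<lambda>(\<rho>, u, S). u - sound_speed a \<kappa> Ti h \<rho> S)"

definition lambda2 :: "real \<Rightarrow> real \<Rightarrow> real \<Rightarrow> real \<Rightarrow> flow_state \<Rightarrow> real" where
  "lambda2 a \<kappa> Ti h = (\<lambda>(\<rho>, u, S). u + sound_speed a \<kappa> Ti h \<rho> S)"

definition R1 :: "real \<Rightarrow> real \<Rightarrow> real \<Rightarrow> real \<Rightarrow> flow_state \<Rightarrow> flow_state" where
  "R1 a \<kappa> Ti h = (\<lambda>(\<rho>, u, S). (-1, sound_speed a \<kappa> Ti h \<rho> S / \<rho>, 0))"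

definition R2 :: "real \<Rightarrow> real \<Rightarrow> real \<Rightarrow> real \<Rightarrow> flow_state \<Rightarrow> flow_state" where
  "R2 a \<kappa> Ti h = (\<lambda>(\<rho>, u, S). (1, sound_speed a \<kappa> Ti h \<rho> S / \<rho>, 0))"

text \<open>
  \<open>R \<bullet> \<nabla>\<lambda> \<noteq> 0\<close>; the existence of the gradient is part of the condition.
\<close>

definition genuinely_nonlinear_at ::
    "('a::real_inner \<Rightarrow> real) \<Rightarrow> ('a \<Rightarrow> 'a) \<Rightarrow> 'a \<Rightarrow> bool" where
  "genuinely_nonlinear_at l R w \<longleftrightarrow> (\<exists>g. GDERIV l w :> g \<and> R w \<bullet> g \<noteq> 0)"

text \<open>
  A region is an open connected set.
\<close>

definition genuinely_nonlinear_region ::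
    "real \<Rightarrow> real \<Rightarrow> real \<Rightarrow> real \<Rightarrow> (real \<times> real) set \<Rightarrow> bool" where
  "genuinely_nonlinear_region a \<kappa> Ti h G \<longleftrightarrow>
     G \<subseteq> states \<and> open G \<and> connected G \<and>
     (\<forall>(\<alpha>, T)\<in>G. \<forall>u.
        genuinely_nonlinear_at (lambda1 a \<kappa> Ti h) (R1 a \<kappa> Ti h)
          (density a \<kappa> Ti \<alpha> T, u, entropy a Ti h \<alpha> T) \<and>
        genuinely_nonlinear_at (lambda2 a \<kappa> Ti h) (R2 a \<kappa> Ti h)
          (density a \<kappa> Ti \<alpha> T, u, entropy a Ti h \<alpha> T))"

definition A_hat :: "real \<Rightarrow> real \<Rightarrow> real \<Rightarrow> real" where
  "A_hat \<kappa> pp Tp = sqrt (Tp powr (5/2) / (\<kappa> * pp))"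

text \<open>
  The ratio \<open>p\<^sub>+ / p\<^sub>-\<close> expressed through \<open>(\<alpha>\<^sub>-, T\<^sub>-)\<close>; here \<open>pp\<close>, \<open>Tp\<close> stand for \<open>p\<^sub>+\<close>, \<open>T\<^sub>+\<close>.
\<close>

definition p_ratio :: "real \<Rightarrow> real \<Rightarrow> real \<Rightarrow> real \<Rightarrow> real \<Rightarrow> real \<Rightarrow> real" where
  "p_ratio \<kappa> Ti pp Tp \<alpha> T =
     \<alpha>\<^sup>2 / ((A_hat \<kappa> pp Tp)\<^sup>2 * (1 - \<alpha>\<^sup>2)) * (Tp / T) powr (5/2) * exp (Ti / T)"

definition approx_hugoniot_locus ::
    "real \<Rightarrow> real \<Rightarrow> real \<Rightarrow> real \<Rightarrow> (real \<times> real) set" where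
  "approx_hugoniot_locus \<kappa> Ti pp Tp =
     {(\<alpha>, T) \<in> states.
        T / Tp * ((4 + p_ratio \<kappa> Ti pp Tp \<alpha> T) * (1 + \<alpha>) + 2 * Ti / T * \<alpha>)
          = 4 + 1 / p_ratio \<kappa> Ti pp Tp \<alpha> T}"

definition approx_hugoniot_curve ::
    "real \<Rightarrow> real \<Rightarrow> real \<Rightarrow> real \<Rightarrow> (real \<times> real) set" where
  "approx_hugoniot_curve \<kappa> Ti pp Tp =
     {(\<alpha>, T) \<in> approx_hugoniot_locus \<kappa> Ti pp Tp. T > Tp}"

end

theory Submission
  imports Defs
begin

text \<open>
  On the locus, \<open>T > Tp\<close> forces \<open>(p\<^sub>+/p\<^sub>-) (1 - \<alpha>\<^sup>2) T/Tp < 1\<close>, which is the bound on \<open>\<alpha>\<close>.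
  Along an isentrope, \<open>T\<close> is a function of \<open>\<alpha>\<close> and the density has a positive logarithmic
  derivative; hence \<open>(\<alpha>, T) \<mapsto> (\<rho>, S)\<close> is an injective local diffeomorphism, and differentiating
  twice along isentropes gives the sound speed and then \<open>\<partial>c/\<partial>\<rho> + c/\<rho>\<close>, whose sign is that of a
  polynomial in \<open>\<alpha>\<close> and \<open>z = Ti/T\<close>. This polynomial is positive when \<open>z \<le> 80\<close>, and also when
  \<open>\<alpha> z\<^sup>3 < 60\<close>; under the hypothesis on the constant, the bound on \<open>\<alpha>\<close> implies the latter as soon as
  \<open>z \<ge> 80\<close>. So the open set below the graph of the bound is genuinely nonlinear, and it is
  connected.
\<close>

section \<open>The state space and the algebraic factors of the sound speed\<close>

lemma statesD:
  assumes "(\<alpha>, T) \<in> states"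
  shows "0 < \<alpha>" "\<alpha> < 1" "0 < T"
  using assms by (auto simp: states_def)

lemma open_states: "open states"
  unfolding states_def by (intro open_Times) auto

text \<open>
  Throughout, \<open>z\<close> stands for \<open>Ti / T\<close>; the squared sound speed is
  \<open>5/3 a\<^sup>2 (1 + \<alpha>) T c_num / c_den\<close>.
\<close>

definition c_num :: "real \<Rightarrow> real \<Rightarrow> real" where
  "c_num \<alpha> z = 1 + \<alpha> * (1 - \<alpha>) * (5/4 + z + z\<^sup>2 / 5)"

definition c_den :: "real \<Rightarrow> real \<Rightarrow> real" where
  "c_den \<alpha> z = 1 + \<alpha> * (1 - \<alpha>) * (5/4 + z + z\<^sup>2 / 3)"

lemma c_num_pos: "0 < \<alpha> \<Longrightarrow> \<alpha> < 1 \<Longrightarrow> 0 < z \<Longrightarrow> 0 < c_num \<alpha> z"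
  unfolding c_num_def by (intro add_pos_nonneg mult_nonneg_nonneg) auto

lemma c_den_pos: "0 < \<alpha> \<Longrightarrow> \<alpha> < 1 \<Longrightarrow> 0 < z \<Longrightarrow> 0 < c_den \<alpha> z"
  unfolding c_den_def by (intro add_pos_nonneg mult_nonneg_nonneg) auto

text \<open>
  The genuine nonlinearity quantity \<open>\<partial>c/\<partial>\<rho> + c/\<rho>\<close>, cleared of its positive denominators.
  The only possibly negative term is the one containing \<open>1 - 2 \<alpha>\<close>.
\<close>

definition gnl_poly :: "real \<Rightarrow> real \<Rightarrow> real" where
  "gnl_poly \<alpha> z = (let w = \<alpha> * (1 - \<alpha>) in
     2 * (4 + w * (5 + 4 * z + z\<^sup>2)) * c_num \<alpha> z * c_den \<alpha> z
     + z * w * ((2 + (5/2 + z) * w) * (4 * z / 15 + w * (z / 3 + 2 * z\<^sup>2 / 15))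
                - 2 * z\<^sup>2 / 15 * (1 + \<alpha>) * (1 - 2 * \<alpha>)))"

section \<open>Positivity of the polynomial \<open>gnl_poly\<close>\<close>

text \<open>Completing the square at s = 2 leaves a positive remainder. Twice the slope 16/3 equals
  2/15 * 80, which is the origin of the threshold z = 80.\<close>

lemma cubic_bound:
  fixes s :: real
  assumes "0 \<le> s"
  shows "16/3 * s < (4 + s) * (1 + s/5) * (1 + s/3)"
proof -
  have "(4 + s) * (1 + s/5) * (1 + s/3) = 16/3 * s + (4/5 * (s - 2)\<^sup>2 + s^3/15 + s + 4/5)"
    by (simp add: field_simps power2_eq_square power3_eq_cube)
  moreover have "0 \<le> 4/5 * (s - 2)\<^sup>2" "0 \<le> s^3/15" using assms by auto
  ultimately show ?thesis using assms by linarith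
qed

text \<open>With w = \<alpha> (1 - \<alpha>) and s = w z^2, each factor of the leading product is
  bounded below by its constant and z^2 terms, and the other nonnegative product is dropped. The
  term containing 1 - 2 \<alpha> is kept exactly.\<close>

lemma gnl_poly_lower:
  assumes "0 < \<alpha>" "\<alpha> < 1" "0 < z"
  shows "2 * ((4 + \<alpha> * (1-\<alpha>) * z\<^sup>2) * (1 + \<alpha> * (1-\<alpha>) * z\<^sup>2 / 5) * (1 + \<alpha> * (1-\<alpha>) * z\<^sup>2 / 3))
      - 2/15 * z * (\<alpha> * (1-\<alpha>) * z\<^sup>2) * ((1+\<alpha>) * (1-2*\<alpha>)) \<le> gnl_poly \<alpha> z"
proof -
  define w where "w = \<alpha> * (1 - \<alpha>)"
  have w: "0 < w" using assms by (simp add: w_def)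
  define s where "s = w * z\<^sup>2"
  have s: "0 < s" using w assms by (simp add: s_def)
  have "4 + s \<le> 4 + w * (5 + 4 * z + z\<^sup>2)" "1 + s/5 \<le> c_num \<alpha> z" "1 + s/3 \<le> c_den \<alpha> z"
    using w assms unfolding s_def c_num_def c_den_def w_def[symmetric]
    by (auto simp: algebra_simps add_nonneg_nonneg)
  then have "(4 + s) * (1 + s/5) * (1 + s/3)
      \<le> (4 + w * (5 + 4 * z + z\<^sup>2)) * c_num \<alpha> z * c_den \<alpha> z"
    using s by (intro mult_mono mult_nonneg_nonneg) auto
  moreover have "0 \<le> z * w * ((2 + (5/2 + z) * w) * (4 * z / 15 + w * (z / 3 + 2 * z\<^sup>2 / 15)))"
    using w assms by (intro mult_nonneg_nonneg add_nonneg_nonneg) auto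
  moreover have "gnl_poly \<alpha> z = 2 * ((4 + w * (5 + 4 * z + z\<^sup>2)) * c_num \<alpha> z * c_den \<alpha> z)
     + z * w * ((2 + (5/2 + z) * w) * (4 * z / 15 + w * (z / 3 + 2 * z\<^sup>2 / 15)))
     - 2/15 * z * s * ((1+\<alpha>) * (1-2*\<alpha>))"
    unfolding gnl_poly_def Let_def w_def[symmetric] s_def
    by (simp add: algebra_simps power2_eq_square)
  ultimately show ?thesis unfolding s_def w_def by linarith
qed

text \<open>Since (1 + \<alpha>) (1 - 2 \<alpha>) \<le> 1, the subtracted term is at most 2/15 * 80
  * s, exactly the amount that \<open>cubic_bound\<close> absorbs.\<close>

lemma gnl_poly_pos_small:
  assumes "0 < \<alpha>" "\<alpha> < 1" "0 < z" "z \<le> 80"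
  shows "0 < gnl_poly \<alpha> z"
proof -
  define s where "s = \<alpha> * (1 - \<alpha>) * z\<^sup>2"
  have s: "0 < s" using assms by (simp add: s_def)
  have "(1+\<alpha>) * (1-2*\<alpha>) = 1 - \<alpha> - 2 * (\<alpha> * \<alpha>)" by (simp add: algebra_simps)
  then have le: "(1+\<alpha>) * (1-2*\<alpha>) \<le> 1"
    using assms mult_pos_pos[of \<alpha> \<alpha>] by linarith
  have "2/15 * z * s * ((1+\<alpha>) * (1-2*\<alpha>)) \<le> 2/15 * z * s * 1"
    using le s assms by (intro mult_left_mono) auto
  also have "\<dots> \<le> 2/15 * 80 * s" using s assms by simp
  also have "\<dots> < 2 * ((4 + s) * (1 + s/5) * (1 + s/3))"
    using cubic_bound[of s] s by linarith
  finally show ?thesis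
    using gnl_poly_lower[OF assms(1-3)] unfolding s_def by linarith
qed

text \<open>Expressed through \<alpha> z^3, the subtracted term stays below 2/15 * 60 = 8, which is
  the value at s = 0 of the increasing positive part.\<close>

lemma gnl_poly_pos_large:
  assumes "0 < \<alpha>" "\<alpha> < 1" "0 < z" "\<alpha> * z^3 < 60"
  shows "0 < gnl_poly \<alpha> z"
proof -
  define s where "s = \<alpha> * (1 - \<alpha>) * z\<^sup>2"
  have s: "0 < s" using assms by (simp add: s_def)
  \<comment> \<open>Multiplying the bounds of the factors requires nonnegative factors; for \<alpha>
    \<ge> 1/2 the product is nonpositive anyway.\<close>
  have le: "(1-\<alpha>) * ((1+\<alpha>) * (1-2*\<alpha>)) \<le> 1 * (1 * 1)"
  proof (cases "1 - 2 * \<alpha> \<le> 0")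
    case True
    then have "(1-\<alpha>) * ((1+\<alpha>) * (1-2*\<alpha>)) \<le> 0"
      using assms by (intro mult_nonneg_nonpos) auto
    then show ?thesis by simp
  next
    case False
    have "(1+\<alpha>) * (1-2*\<alpha>) = 1 - \<alpha> - 2 * (\<alpha> * \<alpha>)" by (simp add: algebra_simps)
    then have "(1+\<alpha>) * (1-2*\<alpha>) \<le> 1"
      using assms mult_pos_pos[of \<alpha> \<alpha>] by linarith
    then have "(1-\<alpha>) * ((1+\<alpha>) * (1-2*\<alpha>)) \<le> 1 * 1"
      using False assms by (intro mult_mono[of "1 - \<alpha>"]) auto
    then show ?thesis by simp
  qed
  have "2/15 * z * s * ((1+\<alpha>) * (1-2*\<alpha>))
      = 2/15 * (\<alpha> * z^3) * ((1-\<alpha>) * ((1+\<alpha>) * (1-2*\<alpha>)))"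
    by (simp add: s_def power2_eq_square power3_eq_cube)
  also have "\<dots> \<le> 2/15 * (\<alpha> * z^3) * (1 * (1 * 1))"
    using le assms by (intro mult_left_mono) auto
  also have "\<dots> < 2 * (4 * 1 * 1)" using assms by simp
  also have "\<dots> \<le> 2 * ((4 + s) * (1 + s/5) * (1 + s/3))"
    using s by (intro mult_left_mono mult_mono) auto
  finally show ?thesis
    using gnl_poly_lower[OF assms(1-3)] unfolding s_def by linarith
qed

text \<open>Shifting to y = (z - 80) / 2 splits exp (z / 2) into exp 40 \<ge> (5/2)^40 and exp y
  \<ge> (1 + y/3)^3, and the latter dominates (z / 80)^3.\<close>

lemma exp_half_dominates_cube:
  fixes z :: real
  assumes "80 \<le> z"
  shows "5.1670 * 10^9 * z^3 < 60 * exp (z / 2)"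
proof -
  define y where "y = (z - 80) / 2"
  have y: "0 \<le> y" using assms by (simp add: y_def)
  have "5/2 \<le> exp (1::real)" using exp_lower_Taylor_quadratic[of "1::real"] by simp
  then have "(5/2)^40 \<le> exp (1::real)^40" by (intro power_mono) auto
  then have e40: "(5/2)^40 \<le> exp (40::real)" by (simp flip: exp_of_nat_mult)
  have "z / 80 \<le> 1 + y / 3" using assms by (simp add: y_def field_simps)
  also have "\<dots> \<le> exp (y / 3)" by (rule exp_ge_add_one_self)
  finally have "(z / 80)^3 \<le> exp (y / 3)^3" using assms by (intro power_mono) auto
  then have "(z / 80)^3 \<le> exp y" by (simp flip: exp_of_nat_mult)
  then have "(5/2)^40 * (z / 80)^3 \<le> exp 40 * exp y"
    using e40 assms by (intro mult_mono) auto
  also have "exp 40 * exp y = exp (z / 2)" by (simp add: y_def flip: exp_add) (simp add: field_simps)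
  finally have "(5/2)^40 * (z / 80)^3 \<le> exp (z / 2)" .
  \<comment> \<open>After cancelling z^3 this is the numerical inequality 5.1670 * 10^9 * 80^3 < 60
    * (5/2)^40.\<close>
  moreover have "5.1670 * 10^9 * z^3 < 60 * ((5/2)^40 * (z / 80)^3)"
    using assms by (simp add: power_divide)
  ultimately show ?thesis by linarith
qed

text \<open>The two regimes cover everything below the bound: beyond z = 80 its exponential decay
  beats z^3 and yields \<alpha> z^3 < 60.\<close>

lemma gnl_poly_pos:
  assumes "0 < \<alpha>" "\<alpha> < 1" "0 < z" "B \<le> 5.1670 * 10^9"
    and bound: "\<alpha> < B * (1 / z) powr (3/4) * exp (- z / 2)"
  shows "0 < gnl_poly \<alpha> z"
proof (cases "z \<le> 80")
  case True
  then show ?thesis using gnl_poly_pos_small assms by simp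
next
  case False
  have "(1 / z) powr (3/4) \<le> 1" using False by (intro powr_le1) auto
  then have "B * (1 / z) powr (3/4) * exp (- z / 2) \<le> 5.1670 * 10^9 * 1 * exp (- z / 2)"
    using assms by (intro mult_right_mono mult_mono) auto
  from less_le_trans[OF bound this] have "\<alpha> < 5.1670 * 10^9 * exp (- z / 2)"
    by (simp only: mult_1_right)
  then have "\<alpha> * z^3 < 5.1670 * 10^9 * exp (- z / 2) * z^3"
    using assms by (intro mult_strict_right_mono) auto
  also have "\<dots> = (5.1670 * 10^9 * z^3) * exp (- z / 2)" by simp
  also have "\<dots> < (60 * exp (z / 2)) * exp (- z / 2)"
    using exp_half_dominates_cube[of z] False by (intro mult_strict_right_mono) auto
  also have "\<dots> = 60" by (simp flip: exp_add)
  finally show ?thesis using gnl_poly_pos_large assms by simp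
qed

section \<open>The bound on \<alpha> along the approximate Hugoniot curve\<close>

text \<open>Here \<open>r\<close>, \<open>\<tau>\<close>, \<open>k\<close> stand for p_+/p_-,
  T_-/T_+ and 2 Ti/T_-. If the bound failed, then r \<tau> \<ge> 1, and the relation multiplied by r
  would give (4 + r) r \<tau> < 4 r + 1. Together with r \<tau> \<ge> 1 this forces r > 1, and
  together with \<tau> > 1 it forces r^2 < 1.\<close>

lemma hugoniot_ratio_bound:
  fixes r \<tau> \<alpha> k :: real
  assumes "0 < r" "1 < \<tau>" "0 < \<alpha>" "\<alpha> < 1" "0 < k"
    and eq: "\<tau> * ((4 + r) * (1 + \<alpha>) + k * \<alpha>) = 4 + 1 / r"
  shows "r * (1 - \<alpha>\<^sup>2) * \<tau> < 1"
proof (rule ccontr)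
  assume "\<not> ?thesis"
  then have ge: "1 \<le> r * \<tau> * (1 - \<alpha>\<^sup>2)" by (simp add: algebra_simps)
  have "r * \<tau> * (1 - \<alpha>\<^sup>2) \<le> r * \<tau> * 1" using assms by (intro mult_left_mono) auto
  with ge have x: "1 \<le> r * \<tau>" by simp
  have "(4 + r) * (r * \<tau>) * 1 < (4 + r) * (r * \<tau>) * (1 + \<alpha>)"
    using assms by (intro mult_strict_left_mono mult_pos_pos) auto
  moreover have "0 < r * \<tau> * (k * \<alpha>)" using assms by simp
  moreover have "r * (\<tau> * ((4 + r) * (1 + \<alpha>) + k * \<alpha>)) = 4 * r + 1"
    unfolding eq using assms by (simp add: field_simps)
  ultimately have lt: "(4 + r) * (r * \<tau>) < 4 * r + 1" by (simp add: algebra_simps)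
  have "(4 + r) * 1 \<le> (4 + r) * (r * \<tau>)" using x assms by (intro mult_left_mono) auto
  with lt have "1 < r" by simp
  have "(4 + r) * r * 1 < (4 + r) * r * \<tau>" using assms by (intro mult_strict_left_mono) auto
  with lt have "(4 + r) * r < 4 * r + 1" by (simp add: mult.assoc)
  then have "r * r < 1" by (simp add: algebra_simps)
  moreover have "1 < r * r" using \<open>1 < r\<close> by (simp add: less_1_mult)
  ultimately show False by simp
qed

text \<open>Both sides reduce to sqrt (Tp / (\<kappa> pp)) * T^(3/4), because Tp^(5/2) = Tp *
  (Tp^(3/4))^2 and Ti^(3/2) = (Ti^(3/4))^2.\<close>

lemma A_hat_eq:
  assumes "\<kappa> > 0" "Ti > 0" "Tp > 0" "pp > 0" "T > 0"
  shows "A_hat \<kappa> pp Tp * (T / Tp) powr (3/4)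
    = sqrt (Tp * Ti powr (3/2) / (\<kappa> * pp)) * (T / Ti) powr (3/4)"
proof -
  have sq: "x powr (3/2) = (x powr (3/4))\<^sup>2" if "x > 0" for x :: real
    using that by (simp add: powr_power)
  have five: "Tp powr (5/2) = Tp * (Tp powr (3/4))\<^sup>2"
    using powr_add[of Tp 1 "3/2"] assms sq[of Tp] by simp
  have "A_hat \<kappa> pp Tp = sqrt (Tp / (\<kappa> * pp)) * Tp powr (3/4)"
    unfolding A_hat_def five by (simp add: real_sqrt_mult real_sqrt_divide)
  moreover have "sqrt (Tp * Ti powr (3/2) / (\<kappa> * pp)) = sqrt (Tp / (\<kappa> * pp)) * Ti powr (3/4)"
    unfolding sq[OF assms(2)] by (simp add: real_sqrt_mult real_sqrt_divide)
  ultimately show ?thesis using assms by (simp add: powr_divide)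
qed

text \<open>Inserting the formula for p_+/p_- into \<open>hugoniot_ratio_bound\<close> cancels 1 -
  \<alpha>^2 and leaves the exponent -3/2 on T/Tp, so the inequality is the square of the
  claim.\<close>

lemma approx_hugoniot_curve_bound:
  assumes "\<kappa> > 0" "Ti > 0" "Tp > 0" "pp > 0"
    and curve: "(\<alpha>, T) \<in> approx_hugoniot_curve \<kappa> Ti pp Tp"
  shows "\<alpha> < A_hat \<kappa> pp Tp * (T / Tp) powr (3/4) * exp (- Ti / (2 * T))"
proof -
  define r where "r = p_ratio \<kappa> Ti pp Tp \<alpha> T"
  define A where "A = A_hat \<kappa> pp Tp"
  have A: "A > 0" using assms by (simp add: A_def A_hat_def)
  have loc: "(\<alpha>, T) \<in> states" "T > Tp"
    and eq: "T / Tp * ((4 + r) * (1 + \<alpha>) + 2 * Ti / T * \<alpha>) = 4 + 1 / r"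
    using curve by (auto simp: approx_hugoniot_curve_def approx_hugoniot_locus_def r_def)
  note \<alpha> = statesD[OF loc(1)]
  have \<alpha>2: "\<alpha>\<^sup>2 < 1" using \<alpha> by (simp add: power_less_one_iff)
  have r_eq: "r = \<alpha>\<^sup>2 / (A\<^sup>2 * (1 - \<alpha>\<^sup>2)) * (Tp / T) powr (5/2) * exp (Ti / T)"
    by (simp add: r_def p_ratio_def A_def)
  have r: "0 < r" unfolding r_eq using \<alpha> \<alpha>2 A assms by simp
  have lt: "r * (1 - \<alpha>\<^sup>2) * (T / Tp) < 1"
    using \<alpha> loc assms r by (intro hugoniot_ratio_bound[OF _ _ _ _ _ eq]) auto
  define q where "q = (T / Tp) powr (3/4)"
  have q: "0 < q" using \<alpha> assms by (simp add: q_def)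
  have "(T / Tp) * (T / Tp) powr (3/2) = (T / Tp) powr (5/2)"
    using powr_add[of "T / Tp" 1 "3/2"] \<alpha> assms by simp
  moreover have "(T / Tp) powr (3/2) = q\<^sup>2"
    using \<alpha> assms by (simp add: q_def powr_power)
  moreover have "(Tp / T) powr (5/2) = 1 / (T / Tp) powr (5/2)"
    using \<alpha> assms by (simp add: powr_divide)
  ultimately have "(Tp / T) powr (5/2) * (T / Tp) = 1 / (T / Tp * q\<^sup>2) * (T / Tp)" by simp
  then have pw: "(Tp / T) powr (5/2) * (T / Tp) = 1 / q\<^sup>2"
    using \<alpha> assms by simp
  \<comment> \<open>\<open>u\<close> is 1 - \<alpha>^2, which occurs in the denominator of
    \<open>p_ratio\<close> and as a factor in \<open>hugoniot_ratio_bound\<close>.\<close>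
  have cancel: "x / (y * u) * v * e * u * t = x / y * (v * t) * e"
    if "u \<noteq> 0" for x y u v e t :: real
    using that by (simp add: divide_simps)
  have "r * (1 - \<alpha>\<^sup>2) * (T / Tp) = \<alpha>\<^sup>2 / A\<^sup>2 * ((Tp / T) powr (5/2) * (T / Tp)) * exp (Ti / T)"
    using \<alpha>2 unfolding r_eq by (intro cancel) simp
  also have "\<dots> = \<alpha>\<^sup>2 / (A * q * exp (- Ti / (2 * T)))\<^sup>2"
    unfolding pw by (simp add: power_mult_distrib exp_minus field_simps flip: exp_double)
  finally have "\<alpha>\<^sup>2 / (A * q * exp (- Ti / (2 * T)))\<^sup>2 < 1" using lt by simp
  then have "\<alpha>\<^sup>2 < (A * q * exp (- Ti / (2 * T)))\<^sup>2"
    using A q by (simp add: divide_less_eq)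
  then have "\<alpha> < A * q * exp (- Ti / (2 * T))"
    using A q by (intro power_less_imp_less_base[of \<alpha> 2]) auto
  then show ?thesis by (simp add: A_def q_def)
qed

section \<open>The open connected set below the graph of the bound\<close>

definition subgraph :: "real \<Rightarrow> real \<Rightarrow> (real \<times> real) set" where
  "subgraph B Ti = {(\<alpha>, T) \<in> states. \<alpha> < B * (T / Ti) powr (3/4) * exp (- Ti / (2 * T))}"

lemma open_subgraph:
  assumes "Ti > 0"
  shows "open (subgraph B Ti)"
proof -
  have "continuous_on states (\<lambda>x. B * (snd x / Ti) powr (3/4) * exp (- Ti / (2 * snd x)))"
    using assms by (intro continuous_intros) (auto simp: states_def)
  with continuous_on_fst[OF continuous_on_id] have "\<exists>A. open A \<and> A \<inter> states
      = {x \<in> states. fst x < B * (snd x / Ti) powr (3/4) * exp (- Ti / (2 * snd x))}"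
    by (rule open_Collect_less_Int)
  then obtain A where A: "open A" "A \<inter> states
      = {x \<in> states. fst x < B * (snd x / Ti) powr (3/4) * exp (- Ti / (2 * snd x))}"
    by blast
  have "subgraph B Ti = A \<inter> states" unfolding A(2) subgraph_def by auto
  then show ?thesis using open_Int[OF A(1) open_states] by simp
qed

text \<open>Rescaling the fibre (0,1) over each T by the positive factor \<open>m T\<close> maps the
  rectangle \<open>states\<close> continuously onto the set.\<close>

lemma connected_subgraph:
  assumes "Ti > 0" "B > 0"
  shows "connected (subgraph B Ti)"
proof -
  \<comment> \<open>The minimum with 1 accounts for \<alpha> < 1 at temperatures where the bound
    exceeds 1.\<close>
  define m where "m T = min 1 (B * (T / Ti) powr (3/4) * exp (- Ti / (2 * T)))" for T
  have m: "0 < m T" "m T \<le> 1" if "0 < T" for T using that assms by (auto simp: m_def)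
  have "subgraph B Ti = (\<lambda>x. (fst x * m (snd x), snd x)) ` states"
  proof (intro equalityI subsetI)
    fix x assume "x \<in> subgraph B Ti"
    then obtain \<alpha> T where x: "x = (\<alpha>, T)" "0 < \<alpha>" "0 < T" "\<alpha> < m T"
      by (auto simp: subgraph_def states_def m_def)
    then show "x \<in> (\<lambda>x. (fst x * m (snd x), snd x)) ` states"
      using m[of T] by (intro image_eqI[of _ _ "(\<alpha> / m T, T)"]) (auto simp: states_def)
  next
    fix x assume "x \<in> (\<lambda>x. (fst x * m (snd x), snd x)) ` states"
    then obtain y where "y \<in> states" and y: "x = (fst y * m (snd y), snd y)" by blast
    moreover define s T where "s = fst y" and "T = snd y"
    ultimately have x: "x = (s * m T, T)" "0 < s" "s < 1" "0 < T"
      by (auto simp: states_def)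
    have "s * m T < 1 * m T" using x m[of T] by (intro mult_strict_right_mono) auto
    then show "x \<in> subgraph B Ti"
      using x m[of T] by (auto simp: subgraph_def states_def m_def)
  qed
  moreover have "continuous_on states (\<lambda>x. (fst x * m (snd x), snd x))"
    unfolding m_def using assms by (intro continuous_intros) (auto simp: states_def)
  moreover have "connected states"
    unfolding states_def by (intro connected_Times) auto
  ultimately show ?thesis by (simp add: connected_continuous_image)
qed

section \<open>The change of variables from (\<alpha>, T) to (\<rho>, S)\<close>

text \<open>This is the map that \<open>pressure_rS\<close> inverts.\<close>

definition rho_S :: "real \<Rightarrow> real \<Rightarrow> real \<Rightarrow> real \<Rightarrow> real \<times> real \<Rightarrow> real \<times> real" where
  "rho_S a \<kappa> Ti h = (\<lambda>(\<alpha>, T). (density a \<kappa> Ti \<alpha> T, entropy a Ti h \<alpha> T))"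

lemma density_pos:
  assumes "a > 0" "\<kappa> > 0" "(\<alpha>, T) \<in> states"
  shows "0 < density a \<kappa> Ti \<alpha> T"
proof -
  note \<alpha> = statesD[OF assms(3)]
  have "\<alpha>\<^sup>2 < 1" using \<alpha> by (simp add: power_less_one_iff)
  then show ?thesis using \<alpha> assms by (simp add: density_def pressure_def)
qed

text \<open>The factor 1 + \<alpha> cancels against 1 - \<alpha>^2. In this form equal densities
  mean equal logarithms, and the differential of the density is the density times a linear
  form.\<close>

lemma density_exp:
  assumes "a > 0" "\<kappa> > 0" "(\<alpha>, T) \<in> states"
  shows "density a \<kappa> Ti \<alpha> T
    = exp (ln (1 - \<alpha>) - 2 * ln \<alpha> + 3/2 * ln T - Ti / T - (ln \<kappa> + 2 * ln a))"
proof -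
  note \<alpha> = statesD[OF assms(3)]
  have five: "T powr (5/2) = T * T powr (3/2)" using powr_add[of T 1 "3/2"] \<alpha> by simp
  have "1 - \<alpha>\<^sup>2 = (1 - \<alpha>) * (1 + \<alpha>)" by (simp add: algebra_simps power2_eq_square)
  then have "density a \<kappa> Ti \<alpha> T = (1 - \<alpha>) / \<alpha>\<^sup>2 * T powr (3/2) * exp (- Ti / T) / (\<kappa> * a\<^sup>2)"
    using \<alpha> assms unfolding density_def pressure_def five by (simp add: divide_simps)
  also have "\<dots> = exp (ln (1 - \<alpha>) - 2 * ln \<alpha> + 3/2 * ln T - Ti / T - (ln \<kappa> + 2 * ln a))"
    using \<alpha> assms unfolding exp_diff exp_add exp_double
    by (simp add: powr_def exp_minus divide_simps)
  finally show ?thesis .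
qed

lemma pressure_eq_density:
  assumes "a > 0" "(\<alpha>, T) \<in> states"
  shows "pressure \<kappa> Ti \<alpha> T = a\<^sup>2 * (density a \<kappa> Ti \<alpha> T * ((1 + \<alpha>) * T))"
  using statesD[OF assms(2)] assms(1) by (simp add: density_def)

text \<open>\<open>dT/d\<alpha>\<close> and \<open>d(ln \<rho>)/d\<alpha>\<close> along an isentrope.\<close>

definition isentrope_slope :: "real \<Rightarrow> real \<Rightarrow> real \<Rightarrow> real" where
  "isentrope_slope Ti \<alpha> T = (2 / (\<alpha> * (1 - \<alpha>)) + 5/2 + Ti / T) * T\<^sup>2 / ((1 + \<alpha>) * Ti)"

definition isentrope_ln_density :: "real \<Rightarrow> real \<Rightarrow> real" where
  "isentrope_ln_density \<alpha> z = 3 * c_den \<alpha> z / (z * \<alpha> * (1 - \<alpha>) * (1 + \<alpha>))"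

lemma isentrope_ln_density_pos:
  "0 < \<alpha> \<Longrightarrow> \<alpha> < 1 \<Longrightarrow> 0 < z \<Longrightarrow> 0 < isentrope_ln_density \<alpha> z"
  unfolding isentrope_ln_density_def using c_den_pos[of \<alpha> z] by simp

text \<open>The left side is the chain rule for ln \<rho> along an isentrope, written in z = Ti / T:
  the partial derivative in \<alpha> plus the one in T times dT/d\<alpha>. The closed form shows its
  sign.\<close>

lemma isentrope_ln_density_eq:
  assumes "0 < \<alpha>" "\<alpha> < 1" "0 < z"
  shows "- (1 / (1 - \<alpha>) + 2 / \<alpha>) + (3 / (2 * z) + 1) * ((2 / (\<alpha> * (1 - \<alpha>)) + 5/2 + z) / (1 + \<alpha>))
    = isentrope_ln_density \<alpha> z"
proof -
  have "\<alpha> \<noteq> 0" "1 - \<alpha> \<noteq> 0" "1 + \<alpha> \<noteq> 0" "z \<noteq> 0" using assms by auto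
  then show ?thesis unfolding isentrope_ln_density_def c_den_def
    by (simp add: divide_simps) (simp add: algebra_simps power2_eq_square)
qed

text \<open>Two states with equal entropy lie on one isentrope, along which ln \<rho> is strictly
  increasing in \<alpha>; equal densities thus force equal \<alpha>, and then the entropy determines
  T.\<close>

lemma inj_on_rho_S:
  assumes "a > 0" "\<kappa> > 0" "Ti > 0"
  shows "inj_on (rho_S a \<kappa> Ti h) states"
proof -
  have False if st: "(\<alpha>, T) \<in> states" "(\<beta>, U) \<in> states" and "\<alpha> < \<beta>"
    and eq: "rho_S a \<kappa> Ti h (\<alpha>, T) = rho_S a \<kappa> Ti h (\<beta>, U)" for \<alpha> T \<beta> U
  proof -
    note \<alpha> = statesD[OF st(1)] and \<beta> = statesD[OF st(2)]
    \<comment> \<open>The additive constant cancels between the two states, so it is set to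
      0.\<close>
    define k where "k = eta Ti 0 \<alpha> T"
    have k: "k = eta Ti 0 \<beta> U"
      using eq assms by (simp add: rho_S_def entropy_def eta_def k_def)
    \<comment> \<open>\<open>zf x\<close> is Ti / T on the isentrope at ionization \<open>x\<close>,
      and \<open>g x\<close> is ln \<rho> there up to an additive constant, with ln T replaced by -
      ln (Ti / T).\<close>
    define zf where "zf x = (k - 2 * ln (x / (1 - x))) / (1 + x) - 5/2" for x
    define g where "g x = ln (1 - x) - 2 * ln x - 3/2 * ln (zf x) - zf x" for x
    have z: "zf \<alpha> = Ti / T" "zf \<beta> = Ti / U"
      using \<alpha> \<beta> by (simp add: zf_def k_def eta_def, simp add: zf_def k eta_def)
    have zf_eq: "zf x * (1 + x) = k - 2 * ln (x / (1 - x)) - 5/2 * (1 + x)" if "0 < x" for x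
      unfolding zf_def left_diff_distrib using that by simp
    \<comment> \<open>\<open>zf x * (1 + x)\<close> decreases in \<open>x\<close>, so positivity at
      the right end \<beta> carries over to the whole interval.\<close>
    have pos: "0 < zf x" if "\<alpha> \<le> x" "x \<le> \<beta>" for x
    proof -
      have x: "0 < x" "x < 1" using that \<alpha> \<beta> by auto
      have "x / (1 - x) \<le> \<beta> / (1 - \<beta>)" using that x \<beta> by (intro frac_le) auto
      then have ln_le: "ln (x / (1 - x)) \<le> ln (\<beta> / (1 - \<beta>))"
        using x \<beta> by (subst ln_le_cancel_iff) auto
      have "0 < zf \<beta> * (1 + \<beta>)" using z \<beta> assms by simp
      also have "\<dots> = k - 2 * ln (\<beta> / (1 - \<beta>)) - 5/2 * (1 + \<beta>)"
        using zf_eq \<beta> by simp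
      also have "\<dots> \<le> k - 2 * ln (x / (1 - x)) - 5/2 * (1 + x)"
        using ln_le that by (intro diff_mono mult_left_mono) auto
      also have "\<dots> = zf x * (1 + x)" using zf_eq x by simp
      finally show ?thesis using x by (simp add: zero_less_mult_iff)
    qed
    have "g \<alpha> < g \<beta>"
    proof (rule DERIV_pos_imp_increasing[OF \<open>\<alpha> < \<beta>\<close>])
      fix x assume x': "\<alpha> \<le> x" "x \<le> \<beta>"
      then have x: "0 < x" "x < 1" using \<alpha> \<beta> by auto
      note zp = pos[OF x']
      \<comment> \<open>In terms of temperature this is - Ti / T^2 times
        \<open>isentrope_slope\<close>.\<close>
      have "(zf has_real_derivative - ((2 / (x * (1 - x)) + (5/2 + zf x)) / (1 + x))) (at x)"
      proof -
        have "((\<lambda>x. ln (x / (1 - x))) has_real_derivative 1 / (x * (1 - x))) (at x)"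
          using x by (auto intro!: derivative_eq_intros simp: divide_simps)
        then have "(zf has_real_derivative
            (- 2 * (1 / (x * (1 - x))) * (1 + x) - (k - 2 * ln (x / (1 - x))) * 1)
              / ((1 + x) * (1 + x))) (at x)"
          unfolding zf_def using x by (auto intro!: derivative_eq_intros)
        moreover have "k - 2 * ln (x / (1 - x)) = (5/2 + zf x) * (1 + x)"
          using x by (simp add: zf_def)
        moreover have "(- 2 * u * y - v * y * 1) / (y * y) = - ((2 * u + v) / y)"
          if "y \<noteq> 0" for u v y :: real
          using that by (simp add: divide_simps) (simp add: algebra_simps)
        from this[of "1 + x" "1 / (x * (1 - x))" "5/2 + zf x"] x
        have "(- 2 * (1 / (x * (1 - x))) * (1 + x) - (5/2 + zf x) * (1 + x) * 1) / ((1 + x) * (1 + x))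
          = - ((2 / (x * (1 - x)) + (5/2 + zf x)) / (1 + x))" by simp
        ultimately show ?thesis by (simp only:)
      qed
      note dz = this
      define r where "r = (2 / (x * (1 - x)) + (5/2 + zf x)) / (1 + x)"
      have "(g has_real_derivative - (1 / (1 - x) + 2 / x) + (3 / (2 * zf x) + 1) * r) (at x)"
        unfolding g_def using x zp
        by (auto intro!: derivative_eq_intros dz[folded r_def] simp: algebra_simps)
      then have "(g has_real_derivative isentrope_ln_density x (zf x)) (at x)"
        using isentrope_ln_density_eq[OF x zp] by (simp add: r_def add.assoc)
      then show "\<exists>y. (g has_real_derivative y) (at x) \<and> 0 < y"
        using isentrope_ln_density_pos[OF x zp] by blast
    qed
    moreover have "g \<alpha> = g \<beta>"
    proof -
      have "density a \<kappa> Ti \<alpha> T = density a \<kappa> Ti \<beta> U" using eq by (simp add: rho_S_def)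
      then have "ln (1 - \<alpha>) - 2 * ln \<alpha> + 3/2 * ln T - Ti / T
          = ln (1 - \<beta>) - 2 * ln \<beta> + 3/2 * ln U - Ti / U"
        using density_exp[OF assms(1,2) st(1), of Ti] density_exp[OF assms(1,2) st(2), of Ti]
        by simp
      moreover have "ln (Ti / T) = ln Ti - ln T" "ln (Ti / U) = ln Ti - ln U"
        using assms \<alpha> \<beta> by (auto simp: ln_div)
      ultimately show ?thesis unfolding g_def z by linarith
    qed
    ultimately show False by simp
  qed
  note ne = this
  show ?thesis
  proof (rule inj_onI)
    fix x y assume x: "x \<in> states" and y: "y \<in> states"
      and eq: "rho_S a \<kappa> Ti h x = rho_S a \<kappa> Ti h y"
    obtain \<alpha> T \<beta> U where xy: "x = (\<alpha>, T)" "y = (\<beta>, U)" by (cases x, cases y)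
    have "\<alpha> = \<beta>"
      using ne[of \<alpha> T \<beta> U] ne[of \<beta> U \<alpha> T] x y eq unfolding xy by (metis linorder_less_linear)
    moreover have "eta Ti 0 \<alpha> T = eta Ti 0 \<beta> U"
      using eq assms by (simp add: xy rho_S_def entropy_def eta_def)
    ultimately have "(1 + \<alpha>) * (Ti / T) = (1 + \<alpha>) * (Ti / U)"
      by (simp add: eta_def distrib_left)
    then have "T = U"
      using x y assms statesD[of \<alpha> T] statesD[of \<beta> U] by (simp add: xy)
    then show "x = y" using \<open>\<alpha> = \<beta>\<close> by (simp add: xy)
  qed
qed

lemma has_derivative_density:
  assumes "a > 0" "\<kappa> > 0" "(\<alpha>, T) \<in> states"
  shows "((\<lambda>x. density a \<kappa> Ti (fst x) (snd x)) has_derivative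
     (\<lambda>x. density a \<kappa> Ti \<alpha> T
        * (- (1 / (1 - \<alpha>) + 2 / \<alpha>) * fst x + (3 / (2 * T) + Ti / T\<^sup>2) * snd x))) (at (\<alpha>, T))"
proof -
  note \<alpha> = statesD[OF assms(3)]
  define f where "f x = ln (1 - fst x) - 2 * ln (fst x) + 3/2 * ln (snd x) - Ti / snd x
     - (ln \<kappa> + 2 * ln a)" for x :: "real \<times> real"
  have d: "((\<lambda>x. ln (1 - fst x)) has_derivative (\<lambda>x. - (1 / (1 - \<alpha>) * fst x))) (at (\<alpha>, T))"
    "((\<lambda>x. ln (fst x)) has_derivative (\<lambda>x. 1 / \<alpha> * fst x)) (at (\<alpha>, T))"
    "((\<lambda>x. ln (snd x)) has_derivative (\<lambda>x. 1 / T * snd x)) (at (\<alpha>, T))"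
    "((\<lambda>x. Ti / snd x) has_derivative (\<lambda>x. - (Ti / T\<^sup>2 * snd x))) (at (\<alpha>, T))"
    using \<alpha> by (auto intro!: derivative_eq_intros simp: fun_eq_iff power2_eq_square)
      (simp_all add: divide_inverse)
  have "(f has_derivative (\<lambda>x. - (1 / (1 - \<alpha>) + 2 / \<alpha>) * fst x
      + (3 / (2 * T) + Ti / T\<^sup>2) * snd x)) (at (\<alpha>, T))"
    unfolding f_def
    by (rule has_derivative_eq_rhs[OF has_derivative_diff[OF has_derivative_diff[OF
          has_derivative_add[OF has_derivative_diff[OF d(1) has_derivative_mult_right[OF d(2)]]
          has_derivative_mult_right[OF d(3)]] d(4)] has_derivative_const]])
      (simp add: fun_eq_iff algebra_simps)
  from has_derivative_exp[OF this]
  have "((\<lambda>x. exp (f x)) has_derivative (\<lambda>x. density a \<kappa> Ti \<alpha> T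
        * (- (1 / (1 - \<alpha>) + 2 / \<alpha>) * fst x + (3 / (2 * T) + Ti / T\<^sup>2) * snd x))) (at (\<alpha>, T))"
    by (simp add: density_exp[OF assms] f_def mult.commute)
  then show ?thesis
    by (rule has_derivative_transform_within_open[OF _ open_states assms(3)])
      (auto simp: f_def density_exp[OF assms(1,2)])
qed

lemma has_derivative_entropy:
  assumes "(\<alpha>, T) \<in> states"
  shows "((\<lambda>x. entropy a Ti h (fst x) (snd x)) has_derivative
     (\<lambda>x. a\<^sup>2 * ((2 / (\<alpha> * (1 - \<alpha>)) + 5/2 + Ti / T) * fst x - (1 + \<alpha>) * Ti / T\<^sup>2 * snd x)))
     (at (\<alpha>, T))"
proof -
  note \<alpha> = statesD[OF assms]
  have "((\<lambda>x. ln (fst x / (1 - fst x))) has_derivative (\<lambda>x. fst x / (\<alpha> * (1 - \<alpha>))))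
      (at (\<alpha>, T))"
    using \<alpha> by (auto intro!: derivative_eq_intros simp: fun_eq_iff divide_simps)
      (auto simp: algebra_simps)
  then show ?thesis unfolding entropy_def eta_def using \<alpha>
    by (auto intro!: derivative_eq_intros simp: fun_eq_iff power2_eq_square)
      (auto simp: field_simps)
qed

lemma continuous_on_rho_S:
  assumes "a > 0" "\<kappa> > 0"
  shows "continuous_on states (rho_S a \<kappa> Ti h)"
proof -
  have rho_S_eq: "rho_S a \<kappa> Ti h = (\<lambda>x. (density a \<kappa> Ti (fst x) (snd x), entropy a Ti h (fst x) (snd x)))"
    by (auto simp: rho_S_def)
  have "isCont (rho_S a \<kappa> Ti h) x" if "x \<in> states" for x
    using has_derivative_continuous[OF has_derivative_Pair[OF has_derivative_density has_derivative_entropy]]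
      that assms unfolding rho_S_eq by (cases x) blast
  then show ?thesis by (simp add: continuous_at_imp_continuous_on)
qed

text \<open>Inverse function theorem with an explicit inverse of the Jacobian. The value at (1, 0)
  is recorded because it is the derivative in \<rho> at constant S: d\<alpha>/d\<rho>, and
  dT/d\<rho> obtained from it by the slope of the isentrope.\<close>

lemma has_derivative_the_inv_rho_S:
  assumes "a > 0" "\<kappa> > 0" "Ti > 0" "(\<alpha>, T) \<in> states"
  defines "L \<equiv> density a \<kappa> Ti \<alpha> T * isentrope_ln_density \<alpha> (Ti / T)"
  obtains \<psi> where
    "(the_inv_into states (rho_S a \<kappa> Ti h) has_derivative \<psi>) (at (rho_S a \<kappa> Ti h (\<alpha>, T)))"
    "\<psi> (1, 0) = (1 / L, isentrope_slope Ti \<alpha> T / L)"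
proof -
  note \<alpha> = statesD[OF assms(4)]
  define \<rho> where "\<rho> = density a \<kappa> Ti \<alpha> T"
  have \<rho>: "0 < \<rho>" using density_pos assms by (simp add: \<rho>_def)
  define l where "l = isentrope_ln_density \<alpha> (Ti / T)"
  have l: "0 < l" using isentrope_ln_density_pos \<alpha> assms by (simp add: l_def)
  define A1 A2 E1 E2 \<tau> where "A1 = - (1 / (1 - \<alpha>) + 2 / \<alpha>)" and "A2 = 3 / (2 * T) + Ti / T\<^sup>2"
    and "E1 = 2 / (\<alpha> * (1 - \<alpha>)) + 5/2 + Ti / T" and "E2 = - ((1 + \<alpha>) * Ti / T\<^sup>2)"
    and "\<tau> = isentrope_slope Ti \<alpha> T"
  have E2: "E2 \<noteq> 0" using \<alpha> assms by (simp add: E2_def)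
  have \<tau>: "E2 * \<tau> = - E1"
    using \<alpha> assms by (simp add: \<tau>_def E1_def E2_def isentrope_slope_def)
  have "A2 * \<tau> = (3 / (2 * (Ti / T)) + 1) * (E1 / (1 + \<alpha>))"
    using \<alpha> assms unfolding \<tau>_def A2_def isentrope_slope_def E1_def[symmetric]
    by (simp add: divide_simps power2_eq_square)
  then have l_eq: "l = A1 + A2 * \<tau>"
    using isentrope_ln_density_eq[of \<alpha> "Ti / T"] \<alpha> assms by (simp add: l_def A1_def E1_def)
  define \<phi> where "\<phi> x = (\<rho> * (A1 * fst x + A2 * snd x), a\<^sup>2 * (E1 * fst x + E2 * snd x))"
    for x :: "real \<times> real"
  \<comment> \<open>The increment of T splits into the part producing the entropy change at fixed
    \<alpha> and the isentropic part \<open>\<tau> * X y\<close>; the density row then determines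
    \<open>X y\<close>, the increment of \<alpha>.\<close>
  define X where "X y = (fst y / \<rho> - A2 * (snd y / a\<^sup>2 / E2)) / l" for y :: "real \<times> real"
  define \<psi> where "\<psi> y = (X y, snd y / a\<^sup>2 / E2 + \<tau> * X y)" for y :: "real \<times> real"
  have rho_S_eq: "rho_S a \<kappa> Ti h = (\<lambda>x. (density a \<kappa> Ti (fst x) (snd x), entropy a Ti h (fst x) (snd x)))"
    by (auto simp: rho_S_def)
  have der: "(rho_S a \<kappa> Ti h has_derivative \<phi>) (at (\<alpha>, T))"
    using has_derivative_Pair[OF has_derivative_density[OF assms(1,2,4)] has_derivative_entropy[OF assms(4)]]
    unfolding rho_S_eq \<phi>_def A1_def A2_def E1_def E2_def \<rho>_def by simp
  have "\<phi> \<circ> \<psi> = id"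
  proof (rule ext)
    fix y :: "real \<times> real"
    define t where "t = snd y / a\<^sup>2 / E2"
    have t: "a\<^sup>2 * (E2 * t) = snd y" using E2 assms by (simp add: t_def)
    have "A1 * X y + A2 * (t + \<tau> * X y) = l * X y + A2 * t" by (simp add: l_eq algebra_simps)
    also have "\<dots> = fst y / \<rho>" using l by (simp add: X_def t_def)
    finally have 1: "\<rho> * (A1 * X y + A2 * (t + \<tau> * X y)) = fst y" using \<rho> by simp
    have "E1 * X y + E2 * (t + \<tau> * X y) = E1 * X y + E2 * t + (E2 * \<tau>) * X y"
      by (simp add: algebra_simps)
    then have 2: "a\<^sup>2 * (E1 * X y + E2 * (t + \<tau> * X y)) = snd y"
      unfolding \<tau> using t by simp
    show "(\<phi> \<circ> \<psi>) y = id y" using 1 2 by (simp add: \<phi>_def \<psi>_def t_def prod_eq_iff)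
  qed
  then have "(the_inv_into states (rho_S a \<kappa> Ti h) has_derivative \<psi>) (at (rho_S a \<kappa> Ti h (\<alpha>, T)))"
    using the_inv_into_f_f[OF inj_on_rho_S[OF assms(1-3)]]
    by (intro has_derivative_inverse_strong[OF open_states assms(4) continuous_on_rho_S[OF assms(1,2)] _ der]) auto
  moreover have "\<psi> (1, 0) = (1 / L, isentrope_slope Ti \<alpha> T / L)"
    by (simp add: \<psi>_def X_def L_def \<rho>_def l_def \<tau>_def)
  ultimately show ?thesis using that by blast
qed

text \<open>Openness lets the closed formula for the sound speed, valid on the image, be
  differentiated in \<rho> and S.\<close>

lemma open_rho_S_image:
  assumes "a > 0" "\<kappa> > 0" "Ti > 0"
  shows "open (rho_S a \<kappa> Ti h ` states)"
  using invariance_of_domain[OF continuous_on_rho_S open_states inj_on_rho_S] assms by blast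

section \<open>The closed formula for the sound speed\<close>

definition csq :: "real \<Rightarrow> real \<Rightarrow> real \<times> real \<Rightarrow> real" where
  "csq a Ti x = a\<^sup>2 * (5/3) * ((1 + fst x) * snd x)
     * (c_num (fst x) (Ti / snd x) / c_den (fst x) (Ti / snd x))"

lemma csq_pos:
  assumes "a > 0" "Ti > 0" "(\<alpha>, T) \<in> states"
  shows "0 < csq a Ti (\<alpha>, T)"
  using statesD[OF assms(3)] assms c_num_pos[of \<alpha> "Ti / T"] c_den_pos[of \<alpha> "Ti / T"]
  by (simp add: csq_def)

text \<open>Write p = a^2 \<rho> (1 + \<alpha>) T and differentiate in \<rho> along the inverse map
  at constant S. The result a^2 ((1 + \<alpha>) T + (T + (1 + \<alpha>) \<tau>) / l), with \<tau>
  the slope and l the logarithmic density derivative, simplifies to \<open>csq\<close>.\<close>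

lemma sound_speed_eq:
  assumes "a > 0" "\<kappa> > 0" "Ti > 0" "x \<in> states" "rho_S a \<kappa> Ti h x = (\<rho>, S)"
  shows "sound_speed a \<kappa> Ti h \<rho> S = sqrt (csq a Ti x)"
proof -
  obtain \<alpha> T where x: "x = (\<alpha>, T)" by (cases x)
  note st = assms(4)[unfolded x]
  note \<alpha> = statesD[OF st]
  let ?g = "the_inv_into states (rho_S a \<kappa> Ti h)"
  define l where "l = isentrope_ln_density \<alpha> (Ti / T)"
  have l: "0 < l" using isentrope_ln_density_pos \<alpha> assms by (simp add: l_def)
  have \<rho>: "\<rho> = density a \<kappa> Ti \<alpha> T" using assms(5) by (simp add: x rho_S_def)
  have \<rho>0: "0 < \<rho>" using density_pos assms st by (simp add: \<rho>)
  define \<tau> where "\<tau> = isentrope_slope Ti \<alpha> T"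
  obtain \<psi> where \<psi>: "(?g has_derivative \<psi>) (at (\<rho>, S))" "\<psi> (1, 0) = (1 / (\<rho> * l), \<tau> / (\<rho> * l))"
    using has_derivative_the_inv_rho_S[OF assms(1-3) st, of h] assms(5)
    unfolding \<rho> x l_def \<tau>_def by metis
  have g: "?g (\<rho>, S) = (\<alpha>, T)"
    using the_inv_into_f_f[OF inj_on_rho_S[OF assms(1-3)] st] assms(5) x by metis
  define A where "A x = - (1 / (1 - \<alpha>) + 2 / \<alpha>) * fst x + (3 / (2 * T) + Ti / T\<^sup>2) * snd x"
    for x :: "real \<times> real"
  define P where "P x = a\<^sup>2 * (\<rho> * ((1 + \<alpha>) * snd x + fst x * T) + \<rho> * A x * ((1 + \<alpha>) * T))"
    for x :: "real \<times> real"
  have "((\<lambda>x. (1 + fst x) * snd x) has_derivative (\<lambda>x. (1 + \<alpha>) * snd x + fst x * T)) (at (\<alpha>, T))"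
    by (auto intro!: derivative_eq_intros)
  from has_derivative_mult_right[OF has_derivative_mult[OF has_derivative_density[OF assms(1,2) st] this],
    of "a\<^sup>2" Ti]
  have "((\<lambda>x. a\<^sup>2 * (density a \<kappa> Ti (fst x) (snd x) * ((1 + fst x) * snd x))) has_derivative P)
      (at (\<alpha>, T))"
    by (simp only: P_def[abs_def] A_def \<rho> fst_conv snd_conv)
  then have "((\<lambda>x. pressure \<kappa> Ti (fst x) (snd x)) has_derivative P) (at (\<alpha>, T))"
    by (rule has_derivative_transform_within_open[OF _ open_states st])
      (auto simp: pressure_eq_density[OF assms(1)])
  then have P: "((\<lambda>x. pressure \<kappa> Ti (fst x) (snd x)) has_derivative P) (at (?g (\<rho>, S)))"
    by (simp add: g)
  have p_eq: "pressure_rS a \<kappa> Ti h r S = pressure \<kappa> Ti (fst (?g (r, S))) (snd (?g (r, S)))" for r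
    unfolding pressure_rS_def rho_S_def by (rule case_prod_beta)
  have "((\<lambda>r. (r, S)) has_derivative (\<lambda>t. (t, 0))) (at \<rho>)"
    by (auto intro!: derivative_eq_intros)
  from has_derivative_compose[OF has_derivative_compose[OF this \<psi>(1)] P]
  have "((\<lambda>r. pressure_rS a \<kappa> Ti h r S) has_derivative (\<lambda>t. P (\<psi> (t, 0)))) (at \<rho>)"
    by (simp only: p_eq)
  moreover have "P (\<psi> (t, 0)) = csq a Ti (\<alpha>, T) * t" for t
  proof -
    have "linear \<psi>" using \<psi>(1) has_derivative_linear by blast
    then have "\<psi> (t, 0) = t *\<^sub>R \<psi> (1, 0)"
      using linear_scale[of \<psi> t "(1, 0)"] by simp
    then have \<psi>t: "\<psi> (t, 0) = (t / (\<rho> * l), \<tau> * t / (\<rho> * l))" by (simp add: \<psi>(2) mult.commute)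
    have "(3 / (2 * T) + Ti / T\<^sup>2) * \<tau>
        = (3 / (2 * (Ti / T)) + 1) * ((2 / (\<alpha> * (1 - \<alpha>)) + 5/2 + Ti / T) / (1 + \<alpha>))"
    proof -
      have "(3 / (2 * T) + Ti / T\<^sup>2) * (E * T\<^sup>2 / ((1 + \<alpha>) * Ti))
         = (3 / (2 * (Ti / T)) + 1) * (E / (1 + \<alpha>))" for E
        using \<alpha> assms by (simp add: divide_simps power2_eq_square)
      then show ?thesis by (simp only: \<tau>_def isentrope_slope_def)
    qed
    then have l_eq: "- (1 / (1 - \<alpha>) + 2 / \<alpha>) + (3 / (2 * T) + Ti / T\<^sup>2) * \<tau> = l"
      using isentrope_ln_density_eq[of \<alpha> "Ti / T"] \<alpha> assms by (simp add: l_def)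
    have lin: "p * (t / v) + s * (\<tau> * t / v) = (p + s * \<tau>) * (t / v)" for p s v
      by (simp add: algebra_simps add_divide_distrib)
    have "A (\<psi> (t, 0)) = (- (1 / (1 - \<alpha>) + 2 / \<alpha>) + (3 / (2 * T) + Ti / T\<^sup>2) * \<tau>) * (t / (\<rho> * l))"
      unfolding A_def \<psi>t fst_conv snd_conv by (rule lin)
    also have "\<dots> = t / \<rho>" unfolding l_eq using l by simp
    finally have At: "A (\<psi> (t, 0)) = t / \<rho>" .
    have "P (\<psi> (t, 0)) = a\<^sup>2 * ((1 + \<alpha>) * T + (T + (1 + \<alpha>) * \<tau>) / l) * t"
      unfolding P_def At unfolding \<psi>t using \<rho>0 l by (simp add: field_simps)
    also have "a\<^sup>2 * ((1 + \<alpha>) * T + (T + (1 + \<alpha>) * \<tau>) / l) = csq a Ti (\<alpha>, T)"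
    proof -
      define z where "z = Ti / T"
      have z: "0 < z" "Ti = z * T" using \<alpha> assms by (auto simp: z_def)
      define w where "w = \<alpha> * (1 - \<alpha>)"
      have w: "0 < w" using \<alpha> by (simp add: w_def)
      have D: "0 < c_den \<alpha> z" using c_den_pos \<alpha> z by simp
      have "(1 + \<alpha>) * \<tau> = T * ((2 / w + 5/2 + z) / z)"
        using \<alpha> z unfolding \<tau>_def isentrope_slope_def w_def[symmetric] z_def[symmetric]
        by (simp add: z(2) power2_eq_square)
      then have "T + (1 + \<alpha>) * \<tau> = T * ((z * w + 2 + (5/2 + z) * w) / (z * w))"
        using w z by (simp add: field_simps)
      moreover have "l = 3 * c_den \<alpha> z / (z * w * (1 + \<alpha>))"
        by (simp add: l_def isentrope_ln_density_def z_def[symmetric] w_def mult.assoc)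
      ultimately have "(T + (1 + \<alpha>) * \<tau>) / l
          = T * (1 + \<alpha>) * ((z * w + 2 + (5/2 + z) * w) / (3 * c_den \<alpha> z))"
        using w z(1) D \<alpha> by simp
      \<comment> \<open>This identity is the source of the numerator \<open>c_num\<close> and of the
        factor 5/3.\<close>
      moreover have "3 * c_den \<alpha> z + (z * w + 2 + (5/2 + z) * w) = 5 * c_num \<alpha> z"
        unfolding c_den_def c_num_def w_def by (simp add: field_simps)
      then have "1 + (z * w + 2 + (5/2 + z) * w) / (3 * c_den \<alpha> z) = 5 / 3 * (c_num \<alpha> z / c_den \<alpha> z)"
        using D by (simp add: field_simps)
      moreover have "(1 + \<alpha>) * T + T * (1 + \<alpha>) * X = T * (1 + \<alpha>) * (1 + X)" for X
        by (simp add: algebra_simps)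
      ultimately have "(1 + \<alpha>) * T + (T + (1 + \<alpha>) * \<tau>) / l
          = T * (1 + \<alpha>) * (5 / 3 * (c_num \<alpha> z / c_den \<alpha> z))"
        by (simp only:)
      then show ?thesis by (simp add: csq_def z_def[symmetric])
    qed
    finally show ?thesis .
  qed
  ultimately have "((\<lambda>r. pressure_rS a \<kappa> Ti h r S) has_real_derivative csq a Ti (\<alpha>, T)) (at \<rho>)"
    by (simp add: has_field_derivative_def)
  then show ?thesis by (simp add: sound_speed_def DERIV_imp_deriv x)
qed

section \<open>The derivative of the squared sound speed along isentropes\<close>

text \<open>With c^2 = \<open>csq\<close> and l = \<open>isentrope_ln_density\<close>, the sum is 2
  c \<rho> l times the genuine nonlinearity quantity. Divided by c^2 it is a sum of logarithmic
  derivatives, and \<open>gnl_poly\<close> is its numerator over a common positive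
  denominator.\<close>

lemma has_derivative_csq:
  assumes "a > 0" "Ti > 0" "(\<alpha>, T) \<in> states" and z: "z = Ti / T"
  obtains Q where "(csq a Ti has_derivative Q) (at (\<alpha>, T))"
    "Q (1, isentrope_slope Ti \<alpha> T) + 2 * csq a Ti (\<alpha>, T) * isentrope_ln_density \<alpha> z
      = csq a Ti (\<alpha>, T) * (gnl_poly \<alpha> z / (z * (\<alpha> * (1 - \<alpha>)) * (1 + \<alpha>) * c_num \<alpha> z * c_den \<alpha> z))"
proof -
  note \<alpha> = statesD[OF assms(3)]
  have z0: "0 < z" and Ti: "Ti = z * T" using \<alpha> assms by (auto simp: z)
  define w N D where "w = \<alpha> * (1 - \<alpha>)" and "N = c_num \<alpha> z" and "D = c_den \<alpha> z"
  have pos: "0 < w" "0 < N" "0 < D"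
    using \<alpha> z0 c_num_pos c_den_pos by (auto simp: w_def N_def D_def)
  define N' where "N' x = (1 - 2 * \<alpha>) * (5/4 + z + z\<^sup>2 / 5) * fst x - w * (1 + 2 * z / 5) * (z * (snd x / T))"
    for x :: "real \<times> real"
  define D' where "D' x = (1 - 2 * \<alpha>) * (5/4 + z + z\<^sup>2 / 3) * fst x - w * (1 + 2 * z / 3) * (z * (snd x / T))"
    for x :: "real \<times> real"
  have dz: "((\<lambda>x. Ti / snd x) has_derivative (\<lambda>x. - (z * (snd x / T)))) (at (\<alpha>, T))"
    using \<alpha> by (auto intro!: derivative_eq_intros simp: fun_eq_iff z)
  \<comment> \<open>\<open>c_num\<close> and \<open>c_den\<close> differ only in the divisor
    \<open>k\<close>, which is 5 or 3.\<close>
  have gen: "((\<lambda>x. 1 + fst x * (1 - fst x) * (5/4 + f x + (f x)\<^sup>2 / k)) has_derivative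
      (\<lambda>x. (1 - 2 * \<alpha>) * (5/4 + z + z\<^sup>2 / k) * fst x - w * (1 + 2 * z / k) * (z * (snd x / T))))
      (at (\<alpha>, T))"
    if "(f has_derivative (\<lambda>x. - (z * (snd x / T)))) (at (\<alpha>, T))" "f (\<alpha>, T) = z" "k \<noteq> 0" for f k
    unfolding w_def using that(2,3) \<alpha>(3)
    by (auto intro!: derivative_eq_intros that(1) simp: fun_eq_iff) (simp add: field_simps)
  have N: "((\<lambda>x. c_num (fst x) (Ti / snd x)) has_derivative N') (at (\<alpha>, T))"
    unfolding c_num_def N'_def using gen[OF dz, of 5] by (simp add: z)
  have D: "((\<lambda>x. c_den (fst x) (Ti / snd x)) has_derivative D') (at (\<alpha>, T))"
    unfolding c_den_def D'_def using gen[OF dz, of 3] by (simp add: z)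
  have ND: "((\<lambda>x. c_num (fst x) (Ti / snd x) / c_den (fst x) (Ti / snd x)) has_derivative
      (\<lambda>x. N / D * (N' x / N - D' x / D))) (at (\<alpha>, T))"
  proof -
    have "(N' x * D - N * D' x) / (D * D) = N / D * (N' x / N - D' x / D)" for x
      using pos by (simp add: field_simps)
    with has_derivative_divide'[OF N D] show ?thesis
      using pos by (simp add: N_def[symmetric] D_def[symmetric] z[symmetric])
  qed
  define Q where "Q x = csq a Ti (\<alpha>, T) * (fst x / (1 + \<alpha>) + snd x / T + N' x / N - D' x / D)"
    for x :: "real \<times> real"
  have "(1 + \<alpha>) * T * (u / (1 + \<alpha>) + v / T) = (1 + \<alpha>) * v + u * T" for u v
    using \<alpha> by (simp add: distrib_left)
  then have TD: "((\<lambda>x. (1 + fst x) * snd x) has_derivative (\<lambda>x. (1 + \<alpha>) * T * (fst x / (1 + \<alpha>) + snd x / T)))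
      (at (\<alpha>, T))"
    by (auto intro!: derivative_eq_intros)
  have "(csq a Ti has_derivative Q) (at (\<alpha>, T))"
  proof -
    have "((\<lambda>x. a\<^sup>2 * (5/3) * ((1 + fst x) * snd x)
       * (c_num (fst x) (Ti / snd x) / c_den (fst x) (Ti / snd x))) has_derivative
       (\<lambda>x. a\<^sup>2 * (5/3) * ((1 + \<alpha>) * T) * (N / D * (N' x / N - D' x / D))
          + a\<^sup>2 * (5/3) * ((1 + \<alpha>) * T * (fst x / (1 + \<alpha>) + snd x / T)) * (N / D))) (at (\<alpha>, T))"
      using has_derivative_mult[OF has_derivative_mult_right[OF TD, of "a\<^sup>2 * (5/3)"] ND]
      by (simp add: N_def D_def z)
    moreover have "u * p * q * (s + t + n - d) = u * p * (q * (n - d)) + u * (p * (s + t)) * q"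
      for u p q n d s t :: real by (simp add: algebra_simps)
    then have "Q x = a\<^sup>2 * (5/3) * ((1 + \<alpha>) * T) * (N / D * (N' x / N - D' x / D))
          + a\<^sup>2 * (5/3) * ((1 + \<alpha>) * T * (fst x / (1 + \<alpha>) + snd x / T)) * (N / D)" for x
      unfolding Q_def csq_def fst_conv snd_conv z[symmetric] N_def[symmetric] D_def[symmetric] .
    ultimately show ?thesis unfolding csq_def[abs_def] by presburger
  qed
  moreover have "Q (1, isentrope_slope Ti \<alpha> T) + 2 * csq a Ti (\<alpha>, T) * isentrope_ln_density \<alpha> z
      = csq a Ti (\<alpha>, T) * (gnl_poly \<alpha> z / (z * w * (1 + \<alpha>) * N * D))"
  proof -
    define e where "e = (1 + \<alpha>) * (1 - 2 * \<alpha>)"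
    define q where "q = 2 + (5/2 + z) * w"
    \<comment> \<open>Common denominator: 1 / (1 + \<alpha>), the slope over T, and the logarithmic
      density derivative become \<open>z * w / K\<close>, \<open>q / K\<close> and
      \<open>3 * D / K\<close>.\<close>
    define K where "K = z * w * (1 + \<alpha>)"
    have K: "0 < K" using pos z0 \<alpha> by (simp add: K_def)
    define x where "x = (1::real, isentrope_slope Ti \<alpha> T)"
    have sT: "snd x / T = q / K"
      using \<alpha> z0 pos unfolding x_def isentrope_slope_def w_def[symmetric] z[symmetric] q_def K_def
      by (simp add: Ti divide_simps power2_eq_square) (simp add: algebra_simps)
    have l: "isentrope_ln_density \<alpha> z = 3 * D / K"
      by (simp add: isentrope_ln_density_def D_def K_def w_def mult.assoc)
    have K1: "1 / (1 + \<alpha>) = z * w / K" using \<alpha> z0 pos by (simp add: K_def)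
    have fac: "(1 - 2 * \<alpha>) * k * K - w * m * (z * q) = z * w * (e * k - m * q)" for k m
      unfolding K_def e_def by (simp add: algebra_simps)
    have N'x: "N' x = z * w * (e * (5/4 + z + z\<^sup>2 / 5) - (1 + 2 * z / 5) * q) / K"
    proof -
      have "N' x * K = (1 - 2 * \<alpha>) * (5/4 + z + z\<^sup>2 / 5) * K - w * (1 + 2 * z / 5) * (z * q)"
        unfolding N'_def sT using K by (simp add: x_def left_diff_distrib)
      then show ?thesis using K unfolding fac by (simp add: eq_divide_eq)
    qed
    have D'x: "D' x = z * w * (e * (5/4 + z + z\<^sup>2 / 3) - (1 + 2 * z / 3) * q) / K"
    proof -
      have "D' x * K = (1 - 2 * \<alpha>) * (5/4 + z + z\<^sup>2 / 3) * K - w * (1 + 2 * z / 3) * (z * q)"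
        unfolding D'_def sT using K by (simp add: x_def left_diff_distrib)
      then show ?thesis using K unfolding fac by (simp add: eq_divide_eq)
    qed
    have N_eq: "N = 1 + w * (5/4 + z + z\<^sup>2 / 5)" and D_eq: "D = 1 + w * (5/4 + z + z\<^sup>2 / 3)"
      by (simp_all add: N_def D_def c_num_def c_den_def w_def)
    have poly: "gnl_poly \<alpha> z = (z * w + q + 6 * D) * (N * D)
        + z * w * (e * (5/4 + z + z\<^sup>2 / 5) - (1 + 2 * z / 5) * q) * D
        - z * w * (e * (5/4 + z + z\<^sup>2 / 3) - (1 + 2 * z / 3) * q) * N"
    proof -
      have "gnl_poly \<alpha> z = 2 * (4 + w * (5 + 4 * z + z\<^sup>2)) * (N * D)
        + z * w * (q * (4 * z / 15 + w * (z / 3 + 2 * z\<^sup>2 / 15)) - 2 * z\<^sup>2 / 15 * e)"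
        by (simp add: gnl_poly_def Let_def w_def[symmetric] N_def[symmetric] D_def[symmetric] q_def e_def)
      moreover have "2 * (4 + w * (5 + 4 * z + z\<^sup>2)) = z * w + q + 6 * D"
        by (simp add: q_def D_eq algebra_simps)
      \<comment> \<open>In the coefficient of \<open>e\<close> the terms with \<open>w\<close>
        cancel, leaving z^2/5 - z^2/3 = -2 z^2/15.\<close>
      moreover have "q * (4 * z / 15 + w * (z / 3 + 2 * z\<^sup>2 / 15)) - 2 * z\<^sup>2 / 15 * e
        = (e * (5/4 + z + z\<^sup>2 / 5) - (1 + 2 * z / 5) * q) * D
          - (e * (5/4 + z + z\<^sup>2 / 3) - (1 + 2 * z / 3) * q) * N"
        unfolding N_eq D_eq by (simp add: field_simps power2_eq_square)
      ultimately have "gnl_poly \<alpha> z = (z * w + q + 6 * D) * (N * D)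
        + z * w * ((e * (5/4 + z + z\<^sup>2 / 5) - (1 + 2 * z / 5) * q) * D
          - (e * (5/4 + z + z\<^sup>2 / 3) - (1 + 2 * z / 3) * q) * N)"
        by (simp only:)
      moreover have "u + v * (m * D - n * N) = u + v * m * D - v * n * N" for u v m n
        by (simp add: algebra_simps)
      ultimately show ?thesis by (simp only:)
    qed
    have "Q x + 2 * csq a Ti (\<alpha>, T) * isentrope_ln_density \<alpha> z
      = csq a Ti (\<alpha>, T) * (1 / (1 + \<alpha>) + snd x / T + N' x / N - D' x / D + 2 * (3 * D / K))"
      by (simp add: Q_def l x_def algebra_simps)
    also have "1 / (1 + \<alpha>) + snd x / T + N' x / N - D' x / D + 2 * (3 * D / K)
      = gnl_poly \<alpha> z / (K * N * D)"
    proof -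
      have "z * w / K + q / K + n / K / N - d / K / D + 2 * (3 * D / K)
        = ((z * w + q + 6 * D) * (N * D) + n * D - d * N) / (K * N * D)" for n d
        using K pos by (simp add: field_simps)
      then show ?thesis unfolding K1 sT N'x D'x poly .
    qed
    finally show ?thesis by (simp add: x_def K_def)
  qed
  ultimately show ?thesis using that by (simp add: w_def N_def D_def)
qed

section \<open>Genuine nonlinearity of the acoustic fields\<close>

text \<open>In finite dimension the adjoint of the derivative, applied to 1, is the
  gradient.\<close>

lemma genuinely_nonlinear_atI:
  fixes l :: "'a::euclidean_space \<Rightarrow> real"
  assumes "(l has_derivative l') (at w)" "l' (R w) \<noteq> 0"
  shows "genuinely_nonlinear_at l R w"
proof -
  have "l' v = v \<bullet> adjoint l' 1" for v
    using adjoint_works[OF has_derivative_linear[OF assms(1)], of v 1] by simp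
  then have "l' = (\<lambda>v. v \<bullet> adjoint l' 1)" by blast
  then show ?thesis using assms unfolding genuinely_nonlinear_at_def gderiv_def by metis
qed

text \<open>Near (\<rho>, S) the sound speed is the square root of \<open>csq\<close> composed with
  the inverse map. \<open>C (1, 0)\<close> is its derivative in \<rho> at constant S, so the second
  conclusion is the positivity of the genuine nonlinearity quantity.\<close>

lemma has_derivative_sound_speed:
  fixes h :: real
  assumes "a > 0" "\<kappa> > 0" "Ti > 0" "(\<alpha>, T) \<in> states"
    and gnl: "0 < gnl_poly \<alpha> (Ti / T)"
  defines "\<rho> \<equiv> density a \<kappa> Ti \<alpha> T" and "S \<equiv> entropy a Ti h \<alpha> T"
  obtains C where "((\<lambda>y. sound_speed a \<kappa> Ti h (fst y) (snd y)) has_derivative C) (at (\<rho>, S))"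
    "0 < C (1, 0) + sound_speed a \<kappa> Ti h \<rho> S / \<rho>"
proof -
  note \<alpha> = statesD[OF assms(4)]
  let ?g = "the_inv_into states (rho_S a \<kappa> Ti h)"
  define z l c where "z = Ti / T" and "l = isentrope_ln_density \<alpha> z" and "c = sqrt (csq a Ti (\<alpha>, T))"
  have z: "0 < z" using \<alpha> assms by (simp add: z_def)
  have l: "0 < l" using isentrope_ln_density_pos \<alpha> z by (simp add: l_def)
  have \<rho>0: "0 < \<rho>" using density_pos assms(1,2,4) by (simp add: \<rho>_def)
  have q: "0 < csq a Ti (\<alpha>, T)" using csq_pos assms by blast
  have c: "0 < c" "c * c = csq a Ti (\<alpha>, T)" using q by (auto simp: c_def)
  have \<rho>S: "rho_S a \<kappa> Ti h (\<alpha>, T) = (\<rho>, S)" by (simp add: rho_S_def \<rho>_def S_def)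
  have inj: "inj_on (rho_S a \<kappa> Ti h) states" using inj_on_rho_S assms by blast
  have g: "?g (\<rho>, S) = (\<alpha>, T)"
    using the_inv_into_f_f[OF inj assms(4)] \<rho>S by simp
  obtain \<psi> where \<psi>: "(?g has_derivative \<psi>) (at (\<rho>, S))"
    "\<psi> (1, 0) = (1 / (\<rho> * l), isentrope_slope Ti \<alpha> T / (\<rho> * l))"
    using has_derivative_the_inv_rho_S[OF assms(1-4), of h] unfolding \<rho>S
    by (auto simp: \<rho>_def l_def z_def)
  obtain Q where Q: "(csq a Ti has_derivative Q) (at (\<alpha>, T))"
    and QL: "Q (1, isentrope_slope Ti \<alpha> T) + 2 * csq a Ti (\<alpha>, T) * l
      = csq a Ti (\<alpha>, T) * (gnl_poly \<alpha> z / (z * (\<alpha> * (1 - \<alpha>)) * (1 + \<alpha>) * c_num \<alpha> z * c_den \<alpha> z))"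
    using has_derivative_csq[OF assms(1,3,4) z_def] unfolding l_def by metis
  have QLpos: "0 < Q (1, isentrope_slope Ti \<alpha> T) + 2 * csq a Ti (\<alpha>, T) * l"
    unfolding QL using q gnl z \<alpha> c_num_pos[of \<alpha> z] c_den_pos[of \<alpha> z]
    by (simp add: z_def[symmetric])
  define C where "C y = Q (\<psi> y) / (2 * c)" for y
  have "((\<lambda>y. csq a Ti (?g y)) has_derivative (\<lambda>y. Q (\<psi> y))) (at (\<rho>, S))"
    using has_derivative_compose[OF \<psi>(1), of "csq a Ti" Q] Q by (simp add: g)
  from has_derivative_real_sqrt[OF _ this]
  have "((\<lambda>y. sqrt (csq a Ti (?g y))) has_derivative C) (at (\<rho>, S))"
    using q by (simp add: g C_def[abs_def] c_def field_simps)
  then have "((\<lambda>y. sound_speed a \<kappa> Ti h (fst y) (snd y)) has_derivative C) (at (\<rho>, S))"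
  proof (rule has_derivative_transform_within_open)
    show "open (rho_S a \<kappa> Ti h ` states)" using open_rho_S_image assms by blast
    show "(\<rho>, S) \<in> rho_S a \<kappa> Ti h ` states" using \<rho>S assms(4) by force
    fix y assume "y \<in> rho_S a \<kappa> Ti h ` states"
    then obtain x where x: "x \<in> states" "y = rho_S a \<kappa> Ti h x" by blast
    then show "sqrt (csq a Ti (?g y)) = sound_speed a \<kappa> Ti h (fst y) (snd y)"
      using sound_speed_eq[OF assms(1-3) x(1), of h "fst y" "snd y"] the_inv_into_f_f[OF inj x(1)] by simp
  qed
  moreover have "0 < C (1, 0) + sound_speed a \<kappa> Ti h \<rho> S / \<rho>"
  proof -
    have s: "sound_speed a \<kappa> Ti h \<rho> S = c"
      using sound_speed_eq[OF assms(1-4) \<rho>S] by (simp add: c_def)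
    have "\<psi> (1, 0) = (1 / (\<rho> * l)) *\<^sub>R (1, isentrope_slope Ti \<alpha> T)" by (simp add: \<psi>(2))
    then have "Q (\<psi> (1, 0)) = (1 / (\<rho> * l)) *\<^sub>R Q (1, isentrope_slope Ti \<alpha> T)"
      by (simp only: linear_scale[OF has_derivative_linear[OF Q]])
    \<comment> \<open>Over the common denominator \<open>2 * c * \<rho> * l\<close> the numerator is
      the sum computed in \<open>has_derivative_csq\<close>.\<close>
    then have "C (1, 0) + sound_speed a \<kappa> Ti h \<rho> S / \<rho>
      = (Q (1, isentrope_slope Ti \<alpha> T) + 2 * csq a Ti (\<alpha>, T) * l) / (2 * c * \<rho> * l)"
      unfolding s c(2)[symmetric] C_def using c(1) \<rho>0 l by (simp add: field_simps)
    then show ?thesis using QLpos c \<rho>0 l by simp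
  qed
  ultimately show ?thesis using that by blast
qed

text \<open>Both directional derivatives equal \<open>C (1, 0)\<close> + c / \<rho>: in the first
  family the minus sign before c and the one in the first component of the characteristic vector
  cancel.\<close>

lemma genuinely_nonlinear_at_lambda:
  fixes u h :: real
  assumes "a > 0" "\<kappa> > 0" "Ti > 0" "(\<alpha>, T) \<in> states"
    and gnl: "0 < gnl_poly \<alpha> (Ti / T)"
  defines "w \<equiv> (density a \<kappa> Ti \<alpha> T, u, entropy a Ti h \<alpha> T)"
  shows "genuinely_nonlinear_at (lambda1 a \<kappa> Ti h) (R1 a \<kappa> Ti h) w"
    and "genuinely_nonlinear_at (lambda2 a \<kappa> Ti h) (R2 a \<kappa> Ti h) w"
proof -
  define \<rho> S where "\<rho> = density a \<kappa> Ti \<alpha> T" and "S = entropy a Ti h \<alpha> T"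
  let ?c = "\<lambda>\<rho> S. sound_speed a \<kappa> Ti h \<rho> S"
  obtain C where C: "((\<lambda>y. ?c (fst y) (snd y)) has_derivative C) (at (\<rho>, S))"
    and pos: "0 < C (1, 0) + ?c \<rho> S / \<rho>"
    using has_derivative_sound_speed[OF assms(1-5), of h] unfolding \<rho>_def S_def by metis
  have w: "w = (\<rho>, u, S)" by (simp add: w_def \<rho>_def S_def)
  have "((\<lambda>x. (fst x, snd (snd x))) has_derivative (\<lambda>x. (fst x, snd (snd x)))) (at w)"
    by (auto intro!: derivative_eq_intros)
  from has_derivative_compose[OF this, of "\<lambda>y. ?c (fst y) (snd y)" C]
  have c': "((\<lambda>x. ?c (fst x) (snd (snd x))) has_derivative (\<lambda>x. C (fst x, snd (snd x)))) (at w)"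
    using C by (simp add: w)
  have u': "((\<lambda>x. fst (snd x)) has_derivative (\<lambda>x. fst (snd x))) (at w)"
    by (auto intro!: derivative_eq_intros)
  have neg: "C (-1, 0) = - C (1, 0)"
    using linear_neg[OF has_derivative_linear[OF C], of "(1, 0)"] by simp
  show "genuinely_nonlinear_at (lambda1 a \<kappa> Ti h) (R1 a \<kappa> Ti h) w"
    using has_derivative_diff[OF u' c'] pos
    by (intro genuinely_nonlinear_atI[where l' = "\<lambda>x. fst (snd x) - C (fst x, snd (snd x))"])
      (auto simp: lambda1_def R1_def case_prod_unfold w neg)
  show "genuinely_nonlinear_at (lambda2 a \<kappa> Ti h) (R2 a \<kappa> Ti h) w"
    using has_derivative_add[OF u' c'] pos
    by (intro genuinely_nonlinear_atI[where l' = "\<lambda>x. fst (snd x) + C (fst x, snd (snd x))"])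
      (auto simp: lambda2_def R2_def case_prod_unfold w)
qed

theorem theorem3p1:
  fixes a \<kappa> Ti h Tp pp :: real
  assumes "a > 0" and "\<kappa> > 0" and "Ti > 0" and "Tp > 0" and "pp > 0"
  shows "(\<forall>\<alpha> T. (\<alpha>, T) \<in> approx_hugoniot_locus \<kappa> Ti pp Tp \<and> T > Tp \<longrightarrow>
            0 < \<alpha> \<and>
            \<alpha> < A_hat \<kappa> pp Tp * (T / Tp) powr (3/4) * exp (- Ti / (2 * T)) \<and>
            A_hat \<kappa> pp Tp * (T / Tp) powr (3/4) * exp (- Ti / (2 * T))
              = sqrt (Tp * Ti powr (3/2) / (\<kappa> * pp)) * (T / Ti) powr (3/4)
                  * exp (- Ti / (2 * T)))
         \<and> (sqrt (Tp * Ti powr (3/2) / (\<kappa> * pp)) \<le> 5.1670 * 10 ^ 9 \<longrightarrow>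
              (\<exists>G. genuinely_nonlinear_region a \<kappa> Ti h G \<and>
                   approx_hugoniot_curve \<kappa> Ti pp Tp \<subseteq> G))"
proof -
  define B where "B = sqrt (Tp * Ti powr (3/2) / (\<kappa> * pp))"
  have B: "0 < B" using assms by (simp add: B_def)
  have bound: "(\<alpha>, T) \<in> states" "\<alpha> < A_hat \<kappa> pp Tp * (T / Tp) powr (3/4) * exp (- Ti / (2 * T))"
    "A_hat \<kappa> pp Tp * (T / Tp) powr (3/4) = B * (T / Ti) powr (3/4)"
    if "(\<alpha>, T) \<in> approx_hugoniot_curve \<kappa> Ti pp Tp" for \<alpha> T
  proof -
    show st: "(\<alpha>, T) \<in> states"
      using that by (auto simp: approx_hugoniot_curve_def approx_hugoniot_locus_def)
    show "\<alpha> < A_hat \<kappa> pp Tp * (T / Tp) powr (3/4) * exp (- Ti / (2 * T))"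
      using approx_hugoniot_curve_bound assms that by blast
    show "A_hat \<kappa> pp Tp * (T / Tp) powr (3/4) = B * (T / Ti) powr (3/4)"
      using A_hat_eq[OF assms(2-5)] statesD[OF st] by (simp add: B_def)
  qed
  have "\<exists>G. genuinely_nonlinear_region a \<kappa> Ti h G \<and> approx_hugoniot_curve \<kappa> Ti pp Tp \<subseteq> G"
    if "B \<le> 5.1670 * 10 ^ 9"
  \<comment> \<open>The witness is the whole set below the graph of the bound, with z = Ti / T
    turning its defining inequality into the hypothesis of \<open>gnl_poly_pos\<close>.\<close>
  proof (intro exI conjI)
    have gnl: "(\<alpha>, T) \<in> states" "0 < gnl_poly \<alpha> (Ti / T)" if "(\<alpha>, T) \<in> subgraph B Ti" for \<alpha> T
    proof -
      show st: "(\<alpha>, T) \<in> states" using that by (simp add: subgraph_def)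
      show "0 < gnl_poly \<alpha> (Ti / T)"
        using that statesD[OF st] assms \<open>B \<le> 5.1670 * 10 ^ 9\<close>
        by (intro gnl_poly_pos[of _ _ B]) (auto simp: subgraph_def mult.commute)
    qed
    show "genuinely_nonlinear_region a \<kappa> Ti h (subgraph B Ti)"
      unfolding genuinely_nonlinear_region_def
      using gnl open_subgraph[OF assms(3)] connected_subgraph[OF assms(3) B]
        genuinely_nonlinear_at_lambda[OF assms(1-3)] by auto
    show "approx_hugoniot_curve \<kappa> Ti pp Tp \<subseteq> subgraph B Ti"
      using bound by (auto simp: subgraph_def)
  qed
  moreover have "(\<alpha>, T) \<in> approx_hugoniot_curve \<kappa> Ti pp Tp"
    if "(\<alpha>, T) \<in> approx_hugoniot_locus \<kappa> Ti pp Tp" "T > Tp" for \<alpha> T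
    using that by (simp add: approx_hugoniot_curve_def)
  ultimately show ?thesis
    unfolding B_def[symmetric] using bound statesD by metis
qed

end
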